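(* Let $K$ be a field, let $m\geq 1$ be an integer, and let $n\geq 2$ be an integer. Let $p(x_1,\ldots,x_m)$ be a nonzero linear polynomial with zero constant term in non-commutative variables over $K$. Suppose that $|K|>\frac{n(n-1)}{3}$. Then $p(UT_n)=UT_n^{(t)}$ for some integer $t$ with $-1\leq t\leq \frac{m}{2}-1$.
   Context: $K\langle X\rangle$ is the free associative algebra over $K$ on non-commuting variables $x_1,x_2,\ldots$; its elements are called polynomials. A polynomial $p(x_1,\ldots,x_m)$ is linear with zero constant term if it has the form $p=\sum_{k=1}^m\sum_{(i_1,\ldots,i_k)\in T_m^k}\lambda_{i_1\cdots i_k}x_{i_1}\cdots x_{i_k}$ with $\lambda_{i_1\cdots i_k}\in K$, where $T_m^k$ is the set of $k$-tuples of pairwise distinct elements of $\{1,\ldots,m\}$. That is, each variable occurs at most once in each monomial (different monomials may involve different sets of variables). $UT_n$ is the algebra of all $n\times n$ upper triangular matrices over $K$. For $t\geq 0$, $UT_n^{(t)}$ is the set of all matrices in $UT_n$ whose $(i,j)$ entries are zero whenever $j-i\leq t$ (so it is $\{0\}$ if $t\geq n-1$), and $UT_n^{(-1)}=UT_n$. For an algebra $\mathcal{A}$ over $K$, $p(\mathcal{A})=\{p(a_1,\ldots,a_m) : a_1,\ldots,a_m\in\mathcal{A}\}$ is the image of $p$ on $\mathcal{A}$. *)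

theory Defs
  imports Jordan_Normal_Form.Matrix "HOL-Library.Poly_Mapping"
begin

text \<open>
  An element of the free associative algebra on the variables \<open>x\<^sub>1, x\<^sub>2, \<dots>\<close> is a finitely
  supported function on words: the word \<open>[i\<^sub>1, \<dots>, i\<^sub>k]\<close> stands for the monomial
  \<open>x\<^bsub>i\<^sub>1\<^esub> \<cdots> x\<^bsub>i\<^sub>k\<^esub>\<close>, and \<open>Poly_Mapping.single w c\<close> is \<open>c\<close> times the monomial \<open>w\<close>.
\<close>

type_synonym 'k ncpoly = "nat list \<Rightarrow>\<^sub>0 'k"

definition distinct_tuples :: "nat \<Rightarrow> nat \<Rightarrow> nat list set" where
  "distinct_tuples m k = {w. length w = k \<and> distinct w \<and> set w \<subseteq> {1..m}}"

text \<open>Linear polynomials in \<open>x\<^sub>1, \<dots>, x\<^sub>m\<close> with zero constant term.\<close>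

definition linear_ncpoly :: "nat \<Rightarrow> 'k::field ncpoly \<Rightarrow> bool" where
  "linear_ncpoly m p \<longleftrightarrow>
    (\<exists>c. p = (\<Sum>k=1..m. \<Sum>w\<in>distinct_tuples m k. Poly_Mapping.single w (c w)))"

text \<open>
  Algebras over \<open>'k\<close> are given by the record \<open>('k, 'a) module\<close>, which has ring operations
  on its carrier and a scalar multiplication.
\<close>

definition ncpoly_eval :: "('k::field, 'a) module \<Rightarrow> 'k ncpoly \<Rightarrow> (nat \<Rightarrow> 'a) \<Rightarrow> 'a" where
  "ncpoly_eval A p a =
    (\<Oplus>\<^bsub>A\<^esub>w\<in>Poly_Mapping.keys p.
      Poly_Mapping.lookup p w \<odot>\<^bsub>A\<^esub> foldr (\<lambda>i b. a i \<otimes>\<^bsub>A\<^esub> b) w \<one>\<^bsub>A\<^esub>)"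

text \<open>The image of \<open>p(x\<^sub>1, \<dots>, x\<^sub>m)\<close>; values of \<open>a\<close> outside \<open>{1..m}\<close> play no role for such \<open>p\<close>.\<close>

definition ncpoly_image :: "nat \<Rightarrow> 'k::field ncpoly \<Rightarrow> ('k, 'a) module \<Rightarrow> 'a set" where
  "ncpoly_image m p A = {ncpoly_eval A p a | a. \<forall>i\<in>{1..m}. a i \<in> carrier A}"

definition UT :: "nat \<Rightarrow> ('k::field, 'k mat) module" where
  "UT n = (module_mat TYPE('k) n n)\<lparr>carrier := {A \<in> carrier_mat n n. upper_triangular A}\<rparr>"

text \<open>
  Matrix indices start at \<open>0\<close> here, which does not change the difference \<open>j - i\<close>. The formula is
  meant for \<open>t \<ge> -1\<close>; for \<open>t = -1\<close> it gives all of \<open>UT n\<close>, see below.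
\<close>

definition UT_diag :: "nat \<Rightarrow> int \<Rightarrow> 'k::field mat set" where
  "UT_diag n t =
    {A \<in> carrier (UT n). \<forall>i<n. \<forall>j<n. int j - int i \<le> t \<longrightarrow> A $$ (i, j) = 0}"

lemma UT_diag_minus_one: "UT_diag n (-1) = carrier (UT n)"
  by (auto simp: UT_diag_def UT_def upper_triangular_def)

lemma UT_diag_zero:
  assumes "t \<ge> int n - 1"
  shows "UT_diag n t = {0\<^sub>m n n}"
proof -
  have "A = 0\<^sub>m n n" if A: "A \<in> UT_diag n t" for A :: "'a mat"
  proof (rule eq_matI)
    fix i j assume "i < dim_row (0\<^sub>m n n :: 'a mat)" "j < dim_col (0\<^sub>m n n :: 'a mat)"
    then show "A $$ (i, j) = 0\<^sub>m n n $$ (i, j)"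
      using A assms by (auto simp: UT_diag_def)
  qed (use A in \<open>auto simp: UT_diag_def UT_def\<close>)
  moreover have "0\<^sub>m n n \<in> (UT_diag n t :: 'a mat set)"
    by (auto simp: UT_diag_def UT_def)
  ultimately show ?thesis by blast
qed

lemma ring_UT: "ring (UT n :: ('k::field, 'k mat) module)"
proof -
  have mult: "A * B \<in> {A \<in> carrier_mat n n. upper_triangular A}"
    if A: "A \<in> carrier_mat n n" "upper_triangular A"
      and B: "B \<in> carrier_mat n n" "upper_triangular B" for A B :: "'k mat"
  proof -
    have "(A * B) $$ (i, j) = 0" if "i < n" "j < i" for i j
    proof -
      have "A $$ (i, k) * B $$ (k, j) = 0" if "k < n" for k
        using A B \<open>i < n\<close> \<open>j < i\<close> that by (cases "k < i") (auto simp: upper_triangular_def)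
      then show ?thesis
        using A B that by (auto simp: times_mat_def scalar_prod_def intro!: sum.neutral)
    qed
    then show ?thesis using A B by (auto simp: upper_triangular_def)
  qed
  have inv: "\<exists>B\<in>{A \<in> carrier_mat n n. upper_triangular A}. B + A = 0\<^sub>m n n"
    if "A \<in> carrier_mat n n" "upper_triangular A" for A :: "'k mat"
    by (rule bexI[of _ "- A"]) (use that in \<open>auto simp: upper_triangular_def intro!: eq_matI\<close>)
  show ?thesis
  proof (rule ringI)
    show "abelian_group (UT n :: ('k, 'k mat) module)"
      by (rule abelian_groupI)
        (use inv in \<open>auto simp: UT_def module_mat_def upper_triangular_def
          comm_add_mat[of _ n n] assoc_add_mat[of _ n n]\<close>)
    show "monoid (UT n :: ('k, 'k mat) module)"
      by (rule monoidI)
        (use mult in \<open>auto simp: UT_def module_mat_def upper_triangular_def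
          assoc_mult_mat[of _ n n _ n _ n]\<close>)
  qed (auto simp: UT_def module_mat_def add_mult_distrib_mat[of _ n n]
      mult_add_distrib_mat[of _ n n _ n])
qed

end

theory Submission
  imports Defs
begin

text \<open>
  Nothing in an entry at position \<open>(i, j)\<close> of a product of upper triangular matrices depends on
  the size of the matrices, only on the block with rows and columns from \<open>i\<close> to \<open>j\<close>. So an
  assignment of matrices to the variables is treated as one array \<open>x\<close>, where \<open>x (k, i, j)\<close> is
  entry \<open>(i, j)\<close> of the matrix for the variable \<open>k\<close>, indices running over all of the naturals, and
  \<open>poly_entry p x i j\<close> is entry \<open>(i, j)\<close> of the value of \<open>p\<close>.

  Let \<open>r\<close> be the least number for which the entry at \<open>(0, r)\<close> is not identically zero. By shifting
  indices, every entry at \<open>(i, j)\<close> with \<open>j - i < r\<close> vanishes on all assignments, so the image lies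
  in the matrices whose entries vanish for \<open>j - i \<le> r - 1\<close>. The theorem holds with \<open>t = r - 1\<close>.

  For the bound on \<open>t\<close>, substitute into a shortest monomial of \<open>p\<close>, letter by letter, the matrix
  units \<open>e\<^sub>0\<^sub>0, e\<^sub>0\<^sub>1, e\<^sub>1\<^sub>1, e\<^sub>1\<^sub>2, \<dots>\<close> (\<open>exists_nonzero_entry\<close>). No other monomial survives, whence
  \<open>r\<close> is at most half the length of that monomial.

  For surjectivity with \<open>r \<ge> 1\<close>, note that a variable \<open>\<kappa>\<close> occurs at most once in a monomial.
  Hence entry \<open>(i, j)\<close> is affine in \<open>x (\<kappa>, u, j)\<close> for \<open>u < j\<close>, and the slope does not involve the
  matrix of \<open>\<kappa>\<close> at all; it involves only the block from \<open>i\<close> to \<open>u\<close> and the diagonal entries at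
  \<open>j\<close> of the other matrices. The slope is therefore an entry of \<open>p\<close> on a block of size \<open>u - i + 2\<close>,
  and by minimality of \<open>r\<close> it vanishes identically when \<open>u < i + r - 1\<close> (\<open>poly_slope_low\<close>), whereas
  for a suitable \<open>\<kappa>\<close> and \<open>u = i + r - 1\<close> it does not (\<open>exists_nonzero_slope\<close>). If the other matrices
  are chosen such that all the slopes with \<open>u = i + r - 1\<close> are nonzero, then the prescribed entries
  form a triangular system in the unknowns \<open>x (\<kappa>, i + r - 1, j)\<close>, to be solved column by column
  and from the bottom to the top of each column (\<open>entries_solvable\<close>).

  The cardinality of the field matters only for this common nonvanishing. The slopes are affine in
  each coordinate, so coordinates can be fixed one at a time, and each slope that involves the
  coordinate forbids at most one value (\<open>common_nonzero\<close>). Counting shows that a coordinate occurs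
  in at most \<open>n (n - 1) / 3\<close> slopes, or in at most one (\<open>card_diagonal_windows\<close>).

  For \<open>r = 0\<close> no such choice is needed: with scalar matrices for all variables but \<open>\<kappa>\<close>, the
  value of \<open>p\<close> is an affine function, with scalar coefficients, of the matrix of \<open>\<kappa>\<close>
  (\<open>all_entries_solvable\<close>).
\<close>

section \<open>Functions affine in each coordinate\<close>

definition affine_fun :: "('k::field \<Rightarrow> 'k) \<Rightarrow> bool" where
  "affine_fun g \<longleftrightarrow> (\<exists>a b. \<forall>c. g c = a + b * c)"

lemma affine_fun_const: "affine_fun (\<lambda>_. a)"
  unfolding affine_fun_def by (rule exI[of _ a], rule exI[of _ 0]) simp

lemma affine_fun_id: "affine_fun (\<lambda>c. c)"
  unfolding affine_fun_def by (rule exI[of _ 0], rule exI[of _ 1]) simp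

lemma affine_fun_update: "affine_fun (\<lambda>c. (x(v := c)) u)"
  by (cases "u = v") (simp_all add: affine_fun_id affine_fun_const)

lemma affine_fun_mult_left: "affine_fun g \<Longrightarrow> affine_fun (\<lambda>c. a * g c)"
  unfolding affine_fun_def by (metis (no_types) distrib_left mult.assoc)

lemma affine_fun_mult_right: "affine_fun g \<Longrightarrow> affine_fun (\<lambda>c. g c * a)"
  using affine_fun_mult_left[of g a] by (simp add: mult.commute)

lemma affine_fun_add:
  assumes "affine_fun g" "affine_fun h"
  shows "affine_fun (\<lambda>c. g c + h c)"
proof -
  obtain a b a' b' where "\<forall>c. g c = a + b * c" "\<forall>c. h c = a' + b' * c"
    using assms unfolding affine_fun_def by blast
  then have "\<forall>c. g c + h c = (a + a') + (b + b') * c" by (simp add: algebra_simps)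
  then show ?thesis unfolding affine_fun_def by blast
qed

lemma affine_fun_sum:
  assumes "\<And>s. s \<in> S \<Longrightarrow> affine_fun (\<lambda>c. g s c)"
  shows "affine_fun (\<lambda>c. \<Sum>s\<in>S. g s c)"
  using assms
  by (induction S rule: infinite_finite_induct) (auto intro: affine_fun_const affine_fun_add)

lemma affine_fun_root_unique:
  assumes "affine_fun g" "g c0 \<noteq> 0" "g c = 0" "g c' = 0"
  shows "c = c'"
proof -
  obtain a b where g: "\<And>c. g c = a + b * c" using assms(1) unfolding affine_fun_def by blast
  have "b * (c - c') = g c - g c'" by (simp add: g algebra_simps)
  then have "b * (c - c') = 0" using assms(3,4) by simp
  moreover have "b \<noteq> 0" using assms(2,3) g[of c0] g[of c] by auto
  ultimately show ?thesis by simp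
qed

text \<open>
  Coordinates are fixed one by one. Every \<open>f e\<close> keeps a witness of its own, which agrees with the
  values fixed so far. Along the next coordinate \<open>v\<close>, the function \<open>f e\<close> is affine and nonzero at its
  witness, so it forbids at most one value if it involves \<open>v\<close> and none otherwise. Fewer functions
  than field elements involve \<open>v\<close>, so some value is allowed by all of them. The set \<open>dep e\<close> bounds
  the coordinates that \<open>f e\<close> involves.
\<close>

lemma common_nonzero:
  fixes f :: "'e \<Rightarrow> ('v \<Rightarrow> 'k::field) \<Rightarrow> 'k"
  assumes "finite V" and I: "finite I"
    and aff: "\<And>e v x. e \<in> I \<Longrightarrow> affine_fun (\<lambda>c. f e (x(v := c)))"
    and dep: "\<And>e v x c. e \<in> I \<Longrightarrow> v \<notin> dep e \<Longrightarrow> f e (x(v := c)) = f e x"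
    and few: "\<And>v. infinite (UNIV :: 'k set) \<or> card {e \<in> I. v \<in> dep e} < card (UNIV :: 'k set)"
    and "\<And>e. e \<in> I \<Longrightarrow> \<exists>x. (\<forall>v. v \<notin> V \<longrightarrow> x v = base v) \<and> f e x \<noteq> 0"
  shows "\<exists>x. \<forall>e\<in>I. f e x \<noteq> 0"
  using assms(1,6)
proof (induction V arbitrary: base rule: finite_induct)
  case empty
  then have "f e base \<noteq> 0" if "e \<in> I" for e using that by (metis empty_iff ext)
  then show ?case by blast
next
  case (insert v V)
  then obtain z where z: "\<And>e u. e \<in> I \<Longrightarrow> u \<notin> insert v V \<Longrightarrow> z e u = base u"
    "\<And>e. e \<in> I \<Longrightarrow> f e (z e) \<noteq> 0" by metis
  define J where "J = {e \<in> I. v \<in> dep e}"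
  define bad where "bad e = {c. f e ((z e)(v := c)) = 0}" for e
  have "finite J" using I by (simp add: J_def)
  have one: "finite (bad e) \<and> card (bad e) \<le> 1" if "e \<in> J" for e
  proof -
    have "\<exists>c. bad e \<subseteq> {c}"
    proof (cases "bad e = {}")
      case False
      then obtain c where c: "c \<in> bad e" by blast
      have "c' = c" if "c' \<in> bad e" for c'
        using affine_fun_root_unique[OF aff[of e "z e" v], of "z e v" c' c]
          z(2)[of e] \<open>e \<in> J\<close> that c by (auto simp: J_def bad_def)
      then show ?thesis by blast
    qed simp
    then show ?thesis
      by (metis card.empty card_insert_disjoint empty_iff finite.emptyI finite.insertI
          One_nat_def card_mono finite_subset)
  qed
  have "card (\<Union>e\<in>J. bad e) \<le> (\<Sum>e\<in>J. card (bad e))" using \<open>finite J\<close> by (rule card_UN_le)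
  also have "\<dots> \<le> (\<Sum>e\<in>J. 1)" using one by (intro sum_mono) auto
  finally have "card (\<Union>e\<in>J. bad e) \<le> card J" by simp
  moreover have "finite (\<Union>e\<in>J. bad e)" using \<open>finite J\<close> one by blast
  ultimately have "(\<Union>e\<in>J. bad e) \<noteq> UNIV" using few[of v] unfolding J_def by auto
  then obtain c where c: "\<And>e. e \<in> J \<Longrightarrow> c \<notin> bad e" by blast
  have "\<exists>x. (\<forall>u. u \<notin> V \<longrightarrow> x u = (base(v := c)) u) \<and> f e x \<noteq> 0" if "e \<in> I" for e
  proof (intro exI conjI)
    show "\<forall>u. u \<notin> V \<longrightarrow> ((z e)(v := c)) u = (base(v := c)) u" using z(1) that by auto
    show "f e ((z e)(v := c)) \<noteq> 0"
      using c[of e] z(2)[OF that] dep[OF that] that by (cases "e \<in> J") (auto simp: J_def bad_def)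
  qed
  then show ?case by (rule insert.IH)
qed

text \<open>
  The unknowns are indexed by the equations themselves. Solving in the order of \<open>rank\<close>, equation \<open>e\<close>
  is met by adjusting its own unknown, which leaves the equations of smaller rank intact.
\<close>

lemma triangular_system_solvable:
  fixes F :: "'e \<Rightarrow> ('e \<Rightarrow> 'k) \<Rightarrow> 'k" and rank :: "'e \<Rightarrow> nat"
  assumes "finite S" and inj: "inj_on rank S"
    and later: "\<And>e e' z c. e \<in> S \<Longrightarrow> e' \<in> S \<Longrightarrow> rank e < rank e' \<Longrightarrow> F e (z(e' := c)) = F e z"
    and solve: "\<And>e z. e \<in> S \<Longrightarrow> \<exists>c. F e (z(e := c)) = B e"
  shows "\<exists>z. \<forall>e\<in>S. F e z = B e"
proof -
  have "\<exists>z. \<forall>e\<in>S. rank e < N \<longrightarrow> F e z = B e" for N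
  proof (induction N)
    case (Suc N)
    then obtain z where z: "\<And>e. e \<in> S \<Longrightarrow> rank e < N \<Longrightarrow> F e z = B e" by blast
    show ?case
    proof (cases "\<exists>e\<in>S. rank e = N")
      case True
      then obtain e where e: "e \<in> S" "rank e = N" by blast
      obtain c where c: "F e (z(e := c)) = B e" using solve[OF e(1)] by blast
      have "F e' (z(e := c)) = B e'" if "e' \<in> S" "rank e' < Suc N" for e'
      proof (cases "rank e' = N")
        case True
        then have "e' = e" using inj e that by (auto dest: inj_onD)
        then show ?thesis using c by simp
      next
        case False
        then show ?thesis using later[OF that(1) e(1)] z that e(2) by simp
      qed
      then show ?thesis by blast
    next
      case False
      then show ?thesis using z by (metis less_SucE)
    qed
  qed simp
  from this[of "Suc (Max (rank ` S))"] show ?thesis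
    using \<open>finite S\<close> by (simp add: le_imp_less_Suc)
qed

text \<open>
  A way to find the distinguished variable \<open>\<kappa>\<close>: if setting many coordinates to zero
  changes a value, then it already changes at one of the steps that set a single coordinate to zero.
\<close>

lemma some_coordinate_matters:
  assumes "finite V" "f (\<lambda>v. if v \<in> V then 0 else x v) \<noteq> f x"
  shows "\<exists>v\<in>V. \<exists>y. f (y(v := 0)) \<noteq> f y"
  using assms
proof (induction V arbitrary: x rule: finite_induct)
  case (insert v V)
  have eq: "(\<lambda>u. if u \<in> insert v V then 0 else x u)
      = (\<lambda>u. if u \<in> V then 0 else x u)(v := 0)" by auto
  show ?case
  proof (cases "f (\<lambda>u. if u \<in> V then 0 else x u) = f x")
    case True
    then show ?thesis using insert.prems unfolding eq by (metis insertI1)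
  next
    case False
    then show ?thesis using insert.IH by blast
  qed
qed simp

section \<open>Entries of monomials\<close>

text \<open>
  The intermediate index runs only from \<open>i\<close> to \<open>j\<close>, which builds upper triangularity into the
  product: values of \<open>x\<close> below the diagonal are never read.
\<close>

fun word_entry :: "(nat \<times> nat \<times> nat \<Rightarrow> 'k::field) \<Rightarrow> nat list \<Rightarrow> nat \<Rightarrow> nat \<Rightarrow> 'k" where
  "word_entry x [] i j = (if i = j then 1 else 0)"
| "word_entry x (k # w) i j = (\<Sum>l=i..j. x (k, i, l) * word_entry x w l j)"

lemma word_entry_below_diagonal: "j < i \<Longrightarrow> word_entry x w i j = 0"
  by (cases w) auto

text \<open>
  Entry \<open>(i, j)\<close> is an invariant of the block from \<open>i\<close> to \<open>j\<close>, wherever the block sits on the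
  diagonal.
\<close>

lemma word_entry_shift:
  assumes "\<And>k a b. k \<in> set w \<Longrightarrow> i \<le> a \<Longrightarrow> a \<le> b \<Longrightarrow> b \<le> j \<Longrightarrow> x (k, a, b) = y (k, a + s, b + s)"
  shows "word_entry y w (i + s) (j + s) = word_entry x w i j"
  using assms
proof (induction w arbitrary: i)
  case (Cons k w)
  have "word_entry y (k # w) (i + s) (j + s)
      = (\<Sum>l=i..j. y (k, i + s, l + s) * word_entry y w (l + s) (j + s))"
    by (simp add: sum.shift_bounds_cl_nat_ivl)
  also have "\<dots> = (\<Sum>l=i..j. x (k, i, l) * word_entry x w l j)"
    by (intro sum.cong refl arg_cong2[of _ _ _ _ "(*)"] Cons.IH) (auto simp: Cons.prems)
  finally show ?case by simp
qed simp

lemmas word_entry_cong = word_entry_shift[where s = 0, simplified]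

lemma word_entry_affine:
  assumes "distinct w"
  shows "affine_fun (\<lambda>c. word_entry (x(v := c)) w i j)"
  using assms
proof (induction w arbitrary: i)
  case (Cons k w)
  obtain k' a b where v: "v = (k', a, b)" by (cases v)
  have "affine_fun (\<lambda>c. (x(v := c)) (k, i, l) * word_entry (x(v := c)) w l j)" for l
  proof (cases "k = k'")
    case True
    then have "word_entry (x(v := c)) w l j = word_entry x w l j" for c
      using Cons.prems v by (intro word_entry_cong) auto
    then show ?thesis
      by (simp del: fun_upd_apply add: affine_fun_mult_right affine_fun_update)
  next
    case False
    then have "(x(v := c)) (k, i, l) = x (k, i, l)" for c using v by simp
    moreover have "affine_fun (\<lambda>c. word_entry (x(v := c)) w l j)"
      using Cons by (simp del: fun_upd_apply)
    ultimately show ?thesis by (simp only: affine_fun_mult_left)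
  qed
  then show ?case by (simp only: word_entry.simps affine_fun_sum)
qed (simp add: affine_fun_const)

text \<open>
  This is the coefficient of \<open>x (\<kappa>, u, j)\<close>, for \<open>u < j\<close>, in \<open>word_entry x w i j\<close>. The entry is a sum
  over monotone paths from \<open>i\<close> to \<open>j\<close> labelled by \<open>w\<close>. Those using the edge \<open>(u, j)\<close> with label
  \<open>\<kappa>\<close> go from \<open>i\<close> to \<open>u\<close> by the letters before \<open>\<kappa>\<close> and stay at \<open>j\<close> for the letters
  after it. The column \<open>j\<close> enters only through its diagonal entries, so \<open>j\<close> need not be adjacent to
  the block from \<open>i\<close> to \<open>u\<close>.
\<close>

fun word_slope ::
  "(nat \<times> nat \<times> nat \<Rightarrow> 'k::field) \<Rightarrow> nat \<Rightarrow> nat \<Rightarrow> nat \<Rightarrow> nat list \<Rightarrow> nat \<Rightarrow> 'k" where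
  "word_slope x \<kappa> u j [] i = 0"
| "word_slope x \<kappa> u j (k # w) i =
    (if k = \<kappa> then (if i = u then word_entry x w j j else 0)
     else (\<Sum>l=i..u. x (k, i, l) * word_slope x \<kappa> u j w l))"

lemma word_slope_beyond: "u < i \<Longrightarrow> word_slope x \<kappa> u j w i = 0"
  by (cases w) auto

lemma word_entry_update:
  assumes "distinct w" "u < j" "i \<le> j"
  shows "word_entry (x((\<kappa>, u, j) := c)) w i j =
    word_entry (x((\<kappa>, u, j) := 0)) w i j + c * word_slope x \<kappa> u j w i"
  using assms
proof (induction w arbitrary: i)
  case (Cons k w)
  let ?x = "\<lambda>c. x((\<kappa>, u, j) := c)"
  show ?case
  proof (cases "k = \<kappa>")
    case True
    \<comment> \<open>By distinctness the letter \<open>\<kappa>\<close> does not occur again in \<open>w\<close>.\<close>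
    have same: "word_entry (?x c) w l j = word_entry x w l j" for c l
      using Cons.prems True by (intro word_entry_cong) auto
    have "(\<Sum>l=i..j. ?x c (\<kappa>, i, l) * word_entry x w l j)
        = (\<Sum>l=i..j. ?x 0 (\<kappa>, i, l) * word_entry x w l j
            + (if l = j then (if i = u then c * word_entry x w j j else 0) else 0))"
      by (intro sum.cong) auto
    also have "\<dots> = (\<Sum>l=i..j. ?x 0 (\<kappa>, i, l) * word_entry x w l j)
        + (if i = u then c * word_entry x w j j else 0)"
      using Cons.prems by (simp add: sum.distrib)
    finally show ?thesis using True same by (simp del: fun_upd_apply)
  next
    case False
    have "(\<Sum>l=i..j. x (k, i, l) * word_entry (?x c) w l j)
        = (\<Sum>l=i..j. x (k, i, l) * word_entry (?x 0) w l j
            + c * (x (k, i, l) * word_slope x \<kappa> u j w l))"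
    proof (intro sum.cong refl)
      fix l assume "l \<in> {i..j}"
      then have "word_entry (?x c) w l j = word_entry (?x 0) w l j + c * word_slope x \<kappa> u j w l"
        using Cons by (simp del: fun_upd_apply)
      then show "x (k, i, l) * word_entry (?x c) w l j = x (k, i, l) * word_entry (?x 0) w l j
          + c * (x (k, i, l) * word_slope x \<kappa> u j w l)"
        by (simp add: algebra_simps)
    qed
    also have "\<dots> = (\<Sum>l=i..j. x (k, i, l) * word_entry (?x 0) w l j)
        + c * (\<Sum>l=i..j. x (k, i, l) * word_slope x \<kappa> u j w l)"
      by (simp add: sum.distrib sum_distrib_left)
    also have "(\<Sum>l=i..j. x (k, i, l) * word_slope x \<kappa> u j w l)
        = (\<Sum>l=i..u. x (k, i, l) * word_slope x \<kappa> u j w l)"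
      using Cons.prems by (intro sum.mono_neutral_right) (auto simp: word_slope_beyond)
    finally show ?thesis using False by simp
  qed
qed simp

text \<open>
  The hypotheses leave the matrix of \<open>\<kappa>\<close> arbitrary, and they move the block and the diagonal
  position \<open>j\<close> independently of each other.
\<close>

lemma word_slope_shift:
  assumes "distinct w"
    and "\<And>k a b. k \<in> set w \<Longrightarrow> k \<noteq> \<kappa> \<Longrightarrow> i \<le> a \<Longrightarrow> a \<le> b \<Longrightarrow> b \<le> u \<Longrightarrow>
      x (k, a, b) = y (k, a + s, b + s)"
    and "\<And>k. k \<in> set w \<Longrightarrow> k \<noteq> \<kappa> \<Longrightarrow> x (k, j, j) = y (k, j', j')"
  shows "word_slope y \<kappa> (u + s) j' w (i + s) = word_slope x \<kappa> u j w i"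
  using assms
proof (induction w arbitrary: i)
  case (Cons k w)
  have diag: "word_entry y v j' j' = word_entry x v j j" if "set v \<subseteq> set w - {\<kappa>}" for v
    using that by (induction v) (use Cons.prems in auto)
  show ?case
  proof (cases "k = \<kappa>")
    case True
    then show ?thesis using diag[of w] Cons.prems by auto
  next
    case False
    have "(\<Sum>l=i+s..u+s. y (k, i + s, l) * word_slope y \<kappa> (u + s) j' w l)
        = (\<Sum>l=i..u. y (k, i + s, l + s) * word_slope y \<kappa> (u + s) j' w (l + s))"
      by (simp add: sum.shift_bounds_cl_nat_ivl)
    also have "\<dots> = (\<Sum>l=i..u. x (k, i, l) * word_slope x \<kappa> u j w l)"
      using False
      by (intro sum.cong refl arg_cong2[of _ _ _ _ "(*)"] Cons.IH) (use Cons.prems in auto)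
    finally show ?thesis using False by simp
  qed
qed simp

lemmas word_slope_cong = word_slope_shift[where s = 0, simplified]

lemma word_slope_affine:
  assumes "distinct w"
  shows "affine_fun (\<lambda>c. word_slope (x(v := c)) \<kappa> u j w i)"
  using assms
proof (induction w arbitrary: i)
  case (Cons k w)
  obtain k' a b where v: "v = (k', a, b)" by (cases v)
  show ?case
  proof (cases "k = \<kappa>")
    case True
    then show ?thesis using Cons.prems
      by (cases "i = u") (simp_all del: fun_upd_apply add: word_entry_affine affine_fun_const)
  next
    case False
    have "affine_fun (\<lambda>c. (x(v := c)) (k, i, l) * word_slope (x(v := c)) \<kappa> u j w l)" for l
    proof (cases "k = k'")
      case True
      then have "word_slope (x(v := c)) \<kappa> u j w l = word_slope x \<kappa> u j w l" for c
        using Cons.prems v by (intro word_slope_cong) auto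
      then show ?thesis
        by (simp del: fun_upd_apply add: affine_fun_mult_right affine_fun_update)
    next
      case False
      then have "(x(v := c)) (k, i, l) = x (k, i, l)" for c using v by simp
      moreover have "affine_fun (\<lambda>c. word_slope (x(v := c)) \<kappa> u j w l)"
        using Cons by (simp del: fun_upd_apply)
      ultimately show ?thesis by (simp only: affine_fun_mult_left)
    qed
    then show ?thesis using False by (simp only: word_slope.simps if_False affine_fun_sum)
  qed
qed (simp add: affine_fun_const)

section \<open>Entries of polynomials\<close>

definition poly_entry :: "'k::field ncpoly \<Rightarrow> (nat \<times> nat \<times> nat \<Rightarrow> 'k) \<Rightarrow> nat \<Rightarrow> nat \<Rightarrow> 'k" where
  "poly_entry p x i j =
    (\<Sum>w\<in>Poly_Mapping.keys p. Poly_Mapping.lookup p w * word_entry x w i j)"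

definition poly_slope ::
  "'k::field ncpoly \<Rightarrow> (nat \<times> nat \<times> nat \<Rightarrow> 'k) \<Rightarrow> nat \<Rightarrow> nat \<Rightarrow> nat \<Rightarrow> nat \<Rightarrow> 'k" where
  "poly_slope p x \<kappa> i u j =
    (\<Sum>w\<in>Poly_Mapping.keys p. Poly_Mapping.lookup p w * word_slope x \<kappa> u j w i)"

lemma linear_ncpoly_keys:
  assumes "linear_ncpoly m p" "w \<in> Poly_Mapping.keys p"
  shows "distinct w" "set w \<subseteq> {1..m}" "w \<noteq> []"
proof -
  obtain c where p: "p = (\<Sum>k=1..m. \<Sum>w\<in>distinct_tuples m k. Poly_Mapping.single w (c w))"
    using assms(1) unfolding linear_ncpoly_def by blast
  have "Poly_Mapping.lookup p w =
      (\<Sum>k=1..m. \<Sum>v\<in>distinct_tuples m k. Poly_Mapping.lookup (Poly_Mapping.single v (c v)) w)"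
    unfolding p by (simp add: lookup_sum)
  moreover have "Poly_Mapping.lookup p w \<noteq> 0" using assms(2) by (simp add: in_keys_iff)
  ultimately obtain k v where "k \<in> {1..m}" "v \<in> distinct_tuples m k"
    "Poly_Mapping.lookup (Poly_Mapping.single v (c v)) w \<noteq> 0"
    by (metis (no_types, lifting) sum.neutral)
  then have "k \<in> {1..m}" "w \<in> distinct_tuples m k"
    by (auto simp: lookup_single when_def split: if_splits)
  then show "distinct w" "set w \<subseteq> {1..m}" "w \<noteq> []" by (auto simp: distinct_tuples_def)
qed


lemma poly_entry_shift:
  assumes "\<And>k a b. i \<le> a \<Longrightarrow> a \<le> b \<Longrightarrow> b \<le> j \<Longrightarrow> x (k, a, b) = y (k, a + s, b + s)"
  shows "poly_entry p y (i + s) (j + s) = poly_entry p x i j"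
  unfolding poly_entry_def
  by (intro sum.cong refl arg_cong2[of _ _ _ _ "(*)"] word_entry_shift) (auto simp: assms)

lemmas poly_entry_cong = poly_entry_shift[where s = 0, simplified]

lemma poly_entry_update:
  assumes "linear_ncpoly m p" "u < j" "i \<le> j"
  shows "poly_entry p (x((\<kappa>, u, j) := c)) i j =
    poly_entry p (x((\<kappa>, u, j) := 0)) i j + c * poly_slope p x \<kappa> i u j"
proof -
  have "poly_entry p (x((\<kappa>, u, j) := c)) i j =
      (\<Sum>w\<in>Poly_Mapping.keys p. Poly_Mapping.lookup p w * word_entry (x((\<kappa>, u, j) := 0)) w i j
        + c * (Poly_Mapping.lookup p w * word_slope x \<kappa> u j w i))"
    unfolding poly_entry_def
  proof (intro sum.cong refl)
    fix w assume "w \<in> Poly_Mapping.keys p"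
    then have "distinct w" using linear_ncpoly_keys(1)[OF assms(1)] by blast
    then show "Poly_Mapping.lookup p w * word_entry (x((\<kappa>, u, j) := c)) w i j
        = Poly_Mapping.lookup p w * word_entry (x((\<kappa>, u, j) := 0)) w i j
          + c * (Poly_Mapping.lookup p w * word_slope x \<kappa> u j w i)"
      unfolding word_entry_update[OF \<open>distinct w\<close> assms(2,3), of x \<kappa> c]
      by (simp add: algebra_simps)
  qed
  then show ?thesis
    by (simp only: sum.distrib sum_distrib_left[symmetric] poly_entry_def poly_slope_def)
qed

lemma poly_slope_shift:
  assumes "linear_ncpoly m p"
    and "\<And>k a b. k \<in> {1..m} \<Longrightarrow> k \<noteq> \<kappa> \<Longrightarrow> i \<le> a \<Longrightarrow> a \<le> b \<Longrightarrow> b \<le> u \<Longrightarrow>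
      x (k, a, b) = y (k, a + s, b + s)"
    and "\<And>k. k \<in> {1..m} \<Longrightarrow> k \<noteq> \<kappa> \<Longrightarrow> x (k, j, j) = y (k, j', j')"
  shows "poly_slope p y \<kappa> (i + s) (u + s) j' = poly_slope p x \<kappa> i u j"
  unfolding poly_slope_def
proof (intro sum.cong refl arg_cong2[of _ _ _ _ "(*)"] word_slope_shift)
  fix w k assume "w \<in> Poly_Mapping.keys p" "k \<in> set w"
  then have "k \<in> {1..m}" using linear_ncpoly_keys(2)[OF assms(1)] by blast
  then show "x (k, a, b) = y (k, a + s, b + s)"
    if "k \<noteq> \<kappa>" "i \<le> a" "a \<le> b" "b \<le> u" for a b using assms(2) that by blast
  show "x (k, j, j) = y (k, j', j')" if "k \<noteq> \<kappa>" using assms(3) \<open>k \<in> {1..m}\<close> that by blast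
qed (use linear_ncpoly_keys(1)[OF assms(1)] in blast)

lemmas poly_slope_cong = poly_slope_shift[where s = 0, simplified]

lemma poly_slope_affine:
  assumes "linear_ncpoly m p"
  shows "affine_fun (\<lambda>c. poly_slope p (x(v := c)) \<kappa> i u j)"
  unfolding poly_slope_def
  by (intro affine_fun_sum affine_fun_mult_left word_slope_affine linear_ncpoly_keys(1)[OF assms])

lemma poly_entry_low:
  assumes low: "\<And>x s. s < r \<Longrightarrow> poly_entry p x 0 s = 0" and "j < i + r"
  shows "poly_entry p x i j = 0"
proof (cases "j < i")
  case True
  then show ?thesis by (simp add: poly_entry_def word_entry_below_diagonal)
next
  case False
  have "poly_entry p x (0 + i) (j - i + i) = poly_entry p (\<lambda>(k, a, b). x (k, a + i, b + i)) 0 (j - i)"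
    by (rule poly_entry_shift) simp
  then show ?thesis using False low[of "j - i"] assms(2) by simp
qed

text \<open>
  If \<open>j\<close> is moved next to the block, to \<open>u + 1\<close>, the slope becomes a difference of two
  values of the entry at \<open>(i, u + 1)\<close>, which vanishes since \<open>u + 1 - i < r\<close>.
\<close>

lemma poly_slope_low:
  assumes lin: "linear_ncpoly m p"
    and low: "\<And>x s. s < r \<Longrightarrow> poly_entry p x 0 s = 0" and "u + 1 < i + r"
  shows "poly_slope p x \<kappa> i u j = 0"
proof (cases "u < i")
  case True
  then show ?thesis by (simp add: poly_slope_def word_slope_beyond)
next
  case False
  define y where "y = (\<lambda>(k, a, b). if a = u + 1 \<and> b = u + 1 then x (k, j, j) else x (k, a, b))"
  have "poly_slope p y \<kappa> i u (u + 1) = poly_slope p x \<kappa> i u j"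
    by (rule poly_slope_cong[OF lin]) (auto simp: y_def)
  moreover have "poly_slope p y \<kappa> i u (u + 1) = 0"
    using poly_entry_update[OF lin, of u "u + 1" i y \<kappa> 1] False assms(3)
      poly_entry_low[of r p "u + 1" i] low by (simp del: fun_upd_apply)
  ultimately show ?thesis by simp
qed

lemma word_entry_zero_column:
  assumes "i < j" "\<And>k a. k \<in> set w \<Longrightarrow> a < j \<Longrightarrow> x (k, a, j) = 0"
  shows "word_entry x w i j = 0"
  using assms
proof (induction w arbitrary: i)
  case (Cons k w)
  have "x (k, i, l) * word_entry x w l j = 0" if "l \<in> {i..j}" for l
    using Cons that by (cases "l = j") auto
  then show ?case unfolding word_entry.simps by (intro sum.neutral) blast
qed simp

text \<open>
  A path from \<open>0\<close> to \<open>Suc q\<close> enters \<open>Suc q\<close> by exactly one off-diagonal edge, so the entry vanishes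
  when the off-diagonal part of column \<open>Suc q\<close> is zero. Hence some coordinate
  of this column has a nonzero slope, and it lies in row \<open>q\<close> since the slopes above are zero.
\<close>

lemma exists_nonzero_slope:
  assumes lin: "linear_ncpoly m p"
    and low: "\<And>x s. s < Suc q \<Longrightarrow> poly_entry p x 0 s = 0"
    and nz: "poly_entry p x 0 (Suc q) \<noteq> 0"
  shows "\<exists>\<kappa> y. poly_slope p y \<kappa> 0 q (Suc q) \<noteq> 0"
proof -
  let ?V = "{1..m} \<times> {0..<Suc q} \<times> {Suc q}"
  let ?f = "\<lambda>x. poly_entry p x 0 (Suc q)"
  have "?f (\<lambda>v. if v \<in> ?V then 0 else x v) = 0"
    unfolding poly_entry_def
  proof (intro sum.neutral ballI)
    fix w assume "w \<in> Poly_Mapping.keys p"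
    then have "set w \<subseteq> {1..m}" using linear_ncpoly_keys(2)[OF lin] by blast
    then have "word_entry (\<lambda>v. if v \<in> ?V then 0 else x v) w 0 (Suc q) = 0"
      by (intro word_entry_zero_column) auto
    then show "Poly_Mapping.lookup p w
        * word_entry (\<lambda>v. if v \<in> ?V then 0 else x v) w 0 (Suc q) = 0" by simp
  qed
  then have "?f (\<lambda>v. if v \<in> ?V then 0 else x v) \<noteq> ?f x" using nz by simp
  then obtain v y where v: "v \<in> ?V" "?f (y(v := 0)) \<noteq> ?f y"
    using some_coordinate_matters[of ?V ?f x] by blast
  then obtain \<kappa> u where \<kappa>: "v = (\<kappa>, u, Suc q)" "u < Suc q" by auto
  have "?f y = ?f (y(v := 0)) + y v * poly_slope p y \<kappa> 0 u (Suc q)"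
    using poly_entry_update[OF lin \<kappa>(2), of 0 y \<kappa> "y v"] \<kappa>(1) by (simp del: fun_upd_apply)
  then have nz': "poly_slope p y \<kappa> 0 u (Suc q) \<noteq> 0" using v(2) by auto
  have "u = q"
    using poly_slope_low[OF lin low, where u = u and i = 0 and x = y and \<kappa> = \<kappa> and j = "Suc q"] nz' \<kappa>(2) by force
  then show ?thesis using nz' by blast
qed

section \<open>A monomial detected by matrix units\<close>

text \<open>
  The letter in position \<open>q\<close> of \<open>w\<close> becomes the matrix unit at \<open>(q div 2, (q + 1) div 2)\<close>, so that the
  positions alternate between staying on the diagonal and moving one step to the right.
\<close>

definition staircase :: "nat list \<Rightarrow> nat \<times> nat \<times> nat \<Rightarrow> 'k::field" where
  "staircase w = (\<lambda>(k, a, b).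
    if \<exists>q<length w. w ! q = k \<and> a = q div 2 \<and> b = (q + 1) div 2 then 1 else 0)"

lemma staircase_nth:
  assumes "distinct w" "q < length w"
  shows "staircase w (w ! q, a, b) = (if a = q div 2 \<and> b = (q + 1) div 2 then 1 else 0)"
  using assms by (auto simp: staircase_def nth_eq_iff_index_eq)

lemma word_entry_staircase_Cons:
  assumes "distinct w" "q < length w"
  shows "word_entry (staircase w) (w ! q # v) a b =
    (if a = q div 2 then word_entry (staircase w) v ((q + 1) div 2) b else 0)"
proof (cases "a = q div 2")
  case True
  have "word_entry (staircase w) (w ! q # v) a b = (\<Sum>l=a..b.
      if l = (q + 1) div 2 then word_entry (staircase w) v ((q + 1) div 2) b else 0)"
    unfolding word_entry.simps by (intro sum.cong refl) (simp add: staircase_nth[OF assms] True)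
  also have "\<dots> = (if (q + 1) div 2 \<in> {a..b}
      then word_entry (staircase w) v ((q + 1) div 2) b else 0)"
    by (simp add: sum.delta)
  finally show ?thesis
    using True by (cases "(q + 1) div 2 \<le> b")
      (simp_all add: word_entry_below_diagonal del: word_entry.simps(2))
qed (simp add: staircase_nth[OF assms])

lemma word_entry_staircase_self:
  assumes "distinct w"
  shows "word_entry (staircase w) w 0 (length w div 2) = 1"
proof -
  have "word_entry (staircase w) (drop q w) (q div 2) (length w div 2) = 1" if "q \<le> length w" for q
    using that
  proof (induction q rule: inc_induct)
    case (step q)
    then show ?case
      by (simp add: Cons_nth_drop_Suc[symmetric] word_entry_staircase_Cons[OF assms]
          del: word_entry.simps(2))
  qed simp
  from this[of 0] show ?thesis by simp
qed

text \<open>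
  Consecutive matrix units with positions \<open>q\<close>, \<open>q'\<close> compose only if \<open>(q + 1) div 2 = q' div 2\<close>, and
  then \<open>q \<le> q'\<close>.
\<close>

lemma word_entry_staircase_sorted:
  assumes w: "distinct w" and "set \<pi> \<subseteq> {..<length w}"
    and "word_entry (staircase w :: _ \<Rightarrow> 'k::field) (map ((!) w) \<pi>) a b \<noteq> 0"
  shows "sorted \<pi> \<and> (\<forall>q\<in>set \<pi>. a \<le> q div 2)"
  using assms(2,3)
proof (induction \<pi> arbitrary: a)
  case (Cons q \<pi>)
  then have "q < length w"
    and "word_entry (staircase w :: _ \<Rightarrow> 'k) (w ! q # map ((!) w) \<pi>) a b \<noteq> 0"
    by (simp_all del: word_entry.simps(2))
  then have "a = q div 2"
    and "word_entry (staircase w :: _ \<Rightarrow> 'k) (map ((!) w) \<pi>) ((q + 1) div 2) b \<noteq> 0"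
    unfolding word_entry_staircase_Cons[OF w \<open>q < length w\<close>] by (auto split: if_splits)
  with Cons have "sorted \<pi>" "\<forall>q'\<in>set \<pi>. (q + 1) div 2 \<le> q' div 2" by auto
  moreover have "q \<le> q'" if "(q + 1) div 2 \<le> q' div 2" for q' :: nat using that by linarith
  ultimately show ?case using \<open>a = q div 2\<close> by (force intro: div_le_mono)
qed simp

text \<open>
  A word \<open>v\<close> with a nonzero entry has only letters of \<open>w\<close>, in their order in \<open>w\<close>. The bound
  on the length excludes proper subwords, which could otherwise survive by leaving out letters that
  stay on the diagonal.
\<close>

lemma word_entry_staircase_other:
  assumes w: "distinct w" and v: "distinct v" "length w \<le> length v"
    and nz: "word_entry (staircase w :: _ \<Rightarrow> 'k::field) v a b \<noteq> 0"
  shows "v = w"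
proof -
  have "set v \<subseteq> set w" using nz
  proof (induction v arbitrary: a)
    case (Cons k v)
    then obtain l where "staircase w (k, a, l) * word_entry (staircase w :: _ \<Rightarrow> 'k) v l b \<noteq> 0"
      by (metis (no_types, lifting) sum.neutral word_entry.simps(2))
    then have "staircase w (k, a, l) \<noteq> (0 :: 'k)" "word_entry (staircase w :: _ \<Rightarrow> 'k) v l b \<noteq> 0"
      by auto
    then show ?case using Cons.IH by (auto simp: staircase_def split: if_splits)
  qed simp
  then have "\<forall>k\<in>set v. \<exists>q<length w. w ! q = k" by (metis in_set_conv_nth subsetD)
  then obtain pos where pos: "\<And>k. k \<in> set v \<Longrightarrow> pos k < length w \<and> w ! pos k = k" by metis
  define \<pi> where "\<pi> = map pos v"
  have v_eq: "v = map ((!) w) \<pi>" using pos by (simp add: \<pi>_def map_idI)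
  have sub: "set \<pi> \<subseteq> {..<length w}" using pos by (auto simp: \<pi>_def)
  have dist: "distinct \<pi>" using v(1) unfolding v_eq by (simp add: distinct_map)
  have "sorted \<pi>" using word_entry_staircase_sorted[OF w sub] nz unfolding v_eq by blast
  have "card (set \<pi>) \<ge> length w" using distinct_card[OF dist] v(2) by (simp add: \<pi>_def del: set_map)
  then have "set \<pi> = {..<length w}" using sub by (intro card_seteq) auto
  then have "\<pi> = [0..<length w]"
    using \<open>sorted \<pi>\<close> dist by (intro sorted_distinct_set_unique) (auto simp: lessThan_atLeast0)
  then show ?thesis using v_eq map_nth[of w] by simp
qed

text \<open>
  For \<open>w\<close> a shortest monomial of \<open>p\<close>, the staircase of \<open>w\<close> ends in column \<open>length w div 2\<close> and picks
  out the coefficient of \<open>w\<close>.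
\<close>

lemma exists_nonzero_entry:
  assumes lin: "linear_ncpoly m p" and "p \<noteq> 0"
  shows "\<exists>s x. 2 * s \<le> m \<and> poly_entry p x 0 s \<noteq> 0"
proof -
  have "Poly_Mapping.keys p \<noteq> {}" using assms(2) by simp
  then obtain w where w: "w \<in> Poly_Mapping.keys p"
    and min: "\<And>v. v \<in> Poly_Mapping.keys p \<Longrightarrow> length w \<le> length v"
    using ex_has_least_nat[of "\<lambda>w. w \<in> Poly_Mapping.keys p" _ length] by blast
  note keys = linear_ncpoly_keys[OF lin]
  let ?x = "staircase w" let ?s = "length w div 2"
  have "poly_entry p ?x 0 ?s = (\<Sum>v\<in>Poly_Mapping.keys p. if v = w then Poly_Mapping.lookup p w else 0)"
    unfolding poly_entry_def
  proof (intro sum.cong refl)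
    fix v assume v: "v \<in> Poly_Mapping.keys p"
    show "Poly_Mapping.lookup p v * word_entry ?x v 0 ?s
        = (if v = w then Poly_Mapping.lookup p w else 0)"
      using word_entry_staircase_other[OF keys(1)[OF w] keys(1)[OF v] min[OF v]]
        word_entry_staircase_self[OF keys(1)[OF w]] by auto
  qed
  also have "\<dots> = Poly_Mapping.lookup p w" using w by (simp add: sum.delta)
  finally have "poly_entry p ?x 0 ?s \<noteq> 0" using w by (simp add: in_keys_iff)
  moreover have "length w \<le> m"
    using card_mono[OF _ keys(2)[OF w]] distinct_card[OF keys(1)[OF w]] by simp
  ultimately show ?thesis by (intro exI[of _ ?s] exI[of _ ?x]) auto
qed


section \<open>Prescribing the entries when the diagonal vanishes\<close>

text \<open>
  The set \<open>C\<close> contains the entries \<open>(i, j)\<close> whose slopes can involve a coordinate in row \<open>a\<close>: either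
  \<open>a\<close> lies in the block that starts at \<open>i\<close>, or \<open>a = j\<close>. With \<open>e = a + 1 - r\<close> (truncated), at most
  \<open>e\<close> elements have \<open>a = j\<close>, and the blocks that contain \<open>a\<close> start at one of \<open>e, \<dots>, e + r - 1\<close>.
  Each start \<open>i\<close> has \<open>n - r - i\<close> columns, so that, with \<open>u = n - r - e\<close> and \<open>h = min r u\<close>, the set
  \<open>C\<close> has at most \<open>e + u + (u - 1) + \<dots> + (u - h + 1)\<close> elements. The exceptional case
  \<open>card C \<le> 1\<close> is needed for \<open>n = 2\<close>, \<open>r = 1\<close>.
\<close>

lemma card_diagonal_windows:
  fixes r n a :: nat
  assumes "1 \<le> r"
  defines "C \<equiv> {(i, j). i + r \<le> j \<and> j < n \<and> (i \<le> a \<and> a < i + r \<or> a = j)}"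
  shows "3 * card C \<le> n * (n - 1) \<or> card C \<le> 1"
proof (cases "a < n \<and> r \<le> n")
  case False
  then have "C = {}" unfolding C_def by auto
  then show ?thesis by simp
next
  case True
  define e u where "e = a + 1 - r" and "u = n - r - e"
  have n: "n = r + e + u" using True assms(1) by (auto simp: e_def u_def)
  define h where "h = min r u"
  have "C \<subseteq> (SIGMA i:{e..<e + h}. {i + r..<n}) \<union> {..<e} \<times> {a}"
    unfolding C_def h_def using n by (auto simp: e_def)
  then have "card C \<le> card ((SIGMA i:{e..<e + h}. {i + r..<n}) \<union> {..<e} \<times> {a})"
    by (intro card_mono) auto
  also have "\<dots> \<le> card (SIGMA i:{e..<e + h}. {i + r..<n}) + card ({..<e} \<times> {a})"
    by (rule card_Un_le)
  also have "\<dots> = (\<Sum>i=e..<e + h. n - (i + r)) + e"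
    by (simp add: card_SigmaI card_cartesian_product)
  also have "(\<Sum>i=e..<e + h. n - (i + r)) = (\<Sum>i=0..<h. u - i)"
    using sum.shift_bounds_nat_ivl[of "\<lambda>i. n - (i + r)" 0 e h] n
    by (simp add: add.commute)
  finally have C: "int (card C) \<le> int (\<Sum>i=0..<h. u - i) + int e" by linarith
  have "h' \<le> u \<Longrightarrow> 2 * int (\<Sum>i=0..<h'. u - i) = 2 * int h' * int u - int h' * (int h' - 1)" for h'
    by (induction h') (auto simp: algebra_simps of_nat_diff)
  then have "2 * int (\<Sum>i=0..<h. u - i) = 2 * int h * int u - int h * (int h - 1)"
    by (simp add: h_def)
  then have C2: "2 * int (card C) \<le> 2 * int h * int u - int h * (int h - 1) + 2 * int e"
    using C by linarith
  show ?thesis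
  proof (cases "card C \<le> 1")
    case False
    have "3 * int (card C) \<le> int n * (int n - 1)"
    proof (cases "h = 0")
      case True
      then have "int (card C) \<le> int e" "2 \<le> int e" "int e + 1 \<le> int n"
        using C2 False assms(1) n by auto
      then have "3 * int (card C) \<le> (int e + 1) * int e"
        using mult_right_mono[of 3 "int e + 1" "int e"] by linarith
      also have "\<dots> \<le> int n * (int n - 1)"
        using \<open>int e + 1 \<le> int n\<close> by (intro mult_mono) auto
      finally show ?thesis .
    next
      case h: False
      define N where "N = int h + int u + int e"
      define d where "d = int u - int h"
      \<comment> \<open>The right-hand side below is \<open>2 N (N - 1)\<close> minus six times the bound on \<open>card C\<close>,
        with \<open>u\<close> written as \<open>h + d\<close>.\<close>
      have d: "0 \<le> d" "int u = int h + d" by (auto simp: d_def h_def)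
      have "0 \<le> int h * (5 * int h - 7) + 2 * int h * d + 2 * (d * (d - 1)) + 2 * int e * int e
          + 8 * int e * (int h - 1) + 4 * d * int e"
      proof (cases "h = 1")
        case True
        have "1 \<le> d + int e" using C2 False True d by (auto simp: algebra_simps)
        then have "1 * 1 \<le> (d + int e) * (d + int e)" using d by (intro mult_mono) auto
        then show ?thesis using True by (simp add: algebra_simps)
      next
        case False
        then have "2 \<le> int h" using h by linarith
        moreover have "0 \<le> d * (d - 1)" using d(1) by (cases "d = 0") auto
        ultimately show ?thesis using d(1)
          by (intro add_nonneg_nonneg) (assumption | simp only: | rule mult_nonneg_nonneg | linarith)+
      qed
      then have "3 * (2 * int h * int u - int h * (int h - 1) + 2 * int e) \<le> 2 * (N * (N - 1))"
        unfolding N_def d(2) by (simp add: algebra_simps)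
      moreover have "2 * c \<le> a \<Longrightarrow> 3 * a \<le> 2 * b \<Longrightarrow> 3 * c \<le> b" for a b c :: int
        by linarith
      ultimately have "3 * int (card C) \<le> N * (N - 1)" using C2 by blast
      also have "\<dots> \<le> int n * (int n - 1)"
        by (rule mult_mono) (use h n in \<open>auto simp: N_def h_def\<close>)
      finally show ?thesis .
    qed
    moreover have "int n * (int n - 1) = int (n * (n - 1))" using n assms(1) by (simp add: of_nat_diff)
    ultimately show ?thesis by linarith
  qed simp
qed

text \<open>
  Here \<open>Suc q\<close> is the number called \<open>r\<close> above. All matrices but that of \<open>\<kappa>\<close> are taken from a common
  nonvanishing point \<open>y\<close> of the slopes, and the unknown \<open>z (i, j)\<close> is put at \<open>(i + q, j)\<close> in the matrix
  of \<open>\<kappa>\<close>, where its slope in equation \<open>(i, j)\<close> is nonzero.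
\<close>

lemma entries_solvable:
  fixes p :: "'k::field ncpoly" and B :: "nat \<Rightarrow> nat \<Rightarrow> 'k"
  assumes lin: "linear_ncpoly m p"
    and low: "\<And>x s. s < Suc q \<Longrightarrow> poly_entry p x 0 s = 0"
    and nz: "poly_entry p x0 0 (Suc q) \<noteq> 0"
    and large: "infinite (UNIV :: 'k set) \<or> n * (n - 1) < 3 * card (UNIV :: 'k set)"
  shows "\<exists>x. \<forall>i j. i + Suc q \<le> j \<and> j < n \<longrightarrow> poly_entry p x i j = B i j"
proof -
  define I where "I = {(i, j). i + Suc q \<le> j \<and> j < n}"
  have "finite I" by (rule finite_subset[of _ "{..n} \<times> {..n}"]) (auto simp: I_def)
  obtain \<kappa> y0 where y0: "poly_slope p y0 \<kappa> 0 q (Suc q) \<noteq> 0"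
    using exists_nonzero_slope[OF lin low nz] by blast
  define f where "f = (\<lambda>(i, j) y. poly_slope p y \<kappa> i (i + q) j)"
  define dep where "dep = (\<lambda>(i, j). {(k :: nat, a, b :: nat). i \<le> a \<and> a < i + Suc q \<or> a = j})"
  let ?V = "{1..m} \<times> {..<n} \<times> {..<n}"
  have "\<exists>y. \<forall>e\<in>I. f e y \<noteq> 0"
  proof (rule common_nonzero[where V = ?V and dep = dep and base = "\<lambda>_. 0"])
    fix e v and x :: "nat \<times> nat \<times> nat \<Rightarrow> 'k" assume e: "e \<in> I"
    obtain i j where ij: "e = (i, j)" by (cases e)
    show "affine_fun (\<lambda>c. f e (x(v := c)))"
      by (simp add: ij f_def poly_slope_affine[OF lin] del: fun_upd_apply)
    show "f e (x(v := c)) = f e x" if "v \<notin> dep e" for c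
      unfolding ij f_def prod.case
      using that by (intro poly_slope_cong[OF lin]) (auto simp: ij dep_def)
  next
    fix v :: "nat \<times> nat \<times> nat"
    obtain k a b where v: "v = (k, a, b)" by (cases v)
    let ?C = "{(i, j). i + Suc q \<le> j \<and> j < n \<and> (i \<le> a \<and> a < i + Suc q \<or> a = j)}"
    have C: "{e \<in> I. v \<in> dep e} = ?C" by (auto simp: I_def dep_def v)
    \<comment> \<open>A field has at least two elements, which settles the case of a single slope.\<close>
    have "finite (UNIV :: 'k set) \<Longrightarrow> card {0, 1 :: 'k} \<le> card (UNIV :: 'k set)"
      by (rule card_mono) auto
    then show "infinite (UNIV :: 'k set) \<or> card {e \<in> I. v \<in> dep e} < card (UNIV :: 'k set)"
      using card_diagonal_windows[of "Suc q" n a] large unfolding C by auto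
  next
    fix e assume "e \<in> I"
    then obtain i j where ij: "e = (i, j)" "i + Suc q \<le> j" "j < n" by (auto simp: I_def)
    \<comment> \<open>The witness \<open>y0\<close> for the block from \<open>0\<close> to \<open>q\<close> is moved to the block that starts at \<open>i\<close>;
      the diagonal of its column \<open>Suc q\<close> moves to \<open>j\<close>, which lies outside the block.\<close>
    define y where "y = (\<lambda>(k, a, b). if (k, a, b) \<notin> ?V then 0
      else if a = j \<and> b = j then y0 (k, Suc q, Suc q) else y0 (k, a - i, b - i))"
    have "poly_slope p y \<kappa> (0 + i) (q + i) j = poly_slope p y0 \<kappa> 0 q (Suc q)"
      by (rule poly_slope_shift[OF lin]) (use ij in \<open>auto simp: y_def\<close>)
    then show "\<exists>x. (\<forall>v. v \<notin> ?V \<longrightarrow> x v = 0) \<and> f e x \<noteq> 0"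
      using y0 by (intro exI[of _ y]) (auto simp: y_def f_def ij add.commute)
  qed (use \<open>finite I\<close> in auto)
  then obtain y where f_y: "\<And>e. e \<in> I \<Longrightarrow> f e y \<noteq> 0" by blast
  have y: "poly_slope p y \<kappa> i (i + q) j \<noteq> 0" if "(i, j) \<in> I" for i j
    using f_y[OF that] by (simp add: f_def)
  define X where "X z = (\<lambda>(k, a, b). if k = \<kappa> then (if q \<le> a then z (a - q, b) else 0)
    else y (k, a, b))" for z :: "nat \<times> nat \<Rightarrow> 'k"
  have X_update: "X (z((i, j) := c)) = (X z)((\<kappa>, i + q, j) := c)" for z i j c
    by (auto simp: X_def fun_eq_iff)
  define F where "F = (\<lambda>(i, j) z. poly_entry p (X z) i j)"
  have step: "F (i, j) (z((i', j) := c)) = F (i, j) (z((i', j) := 0))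
      + c * poly_slope p (X z) \<kappa> i (i' + q) j" if "(i, j) \<in> I" "(i', j) \<in> I" for i i' j z c
    unfolding F_def prod.case X_update
    by (rule poly_entry_update[OF lin]) (use that in \<open>auto simp: I_def\<close>)
  \<comment> \<open>The rank orders positions by column first, then from the bottom row to the top.\<close>
  have rank_less: "j * n + (n - 1 - i) < j' * n + (n - 1 - i')" if "j < j'" "0 < n" for i j i' j'
  proof -
    have "j * n + (n - 1 - i) < Suc j * n" using that(2) by simp
    also have "\<dots> \<le> j' * n" using that(1) by (intro mult_le_mono1) simp
    finally show ?thesis by simp
  qed
  have "\<exists>z. \<forall>e\<in>I. F e z = (case e of (i, j) \<Rightarrow> B i j)"
  proof (rule triangular_system_solvable[where rank = "\<lambda>(i, j). j * n + (n - 1 - i)"])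
    show "inj_on (\<lambda>(i, j). j * n + (n - 1 - i)) I"
    proof (rule inj_onI, clarify)
      fix i j i' j' assume "(i, j) \<in> I" "(i', j') \<in> I"
        and eq: "j * n + (n - 1 - i) = j' * n + (n - 1 - i')"
      then have "i < n" "i' < n" by (auto simp: I_def)
      then have "\<not> j < j'" "\<not> j' < j"
        using rank_less[of j j' i i'] rank_less[of j' j i' i] eq by linarith+
      then have "j = j'" by simp
      with \<open>i < n\<close> \<open>i' < n\<close> show "i = i' \<and> j = j'" using eq by auto
    qed
  next
    fix e e' z and c :: 'k
    assume e: "e \<in> I" "e' \<in> I"
      and less: "(case e of (i, j) \<Rightarrow> j * n + (n - 1 - i)) < (case e' of (i, j) \<Rightarrow> j * n + (n - 1 - i))"
    obtain i j i' j' where ij: "e = (i, j)" "e' = (i', j')" by (cases e, cases e')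
    have "0 < n" using e(1) ij(1) by (auto simp: I_def)
    then have "j < j' \<or> j = j' \<and> i' < i"
      using rank_less[of j' j i' i] less unfolding ij by (cases j j' rule: linorder_cases) auto
    then show "F e (z(e' := c)) = F e z"
    proof
      assume "j < j'"
      then show ?thesis unfolding ij F_def prod.case X_update by (intro poly_entry_cong) auto
    next
      assume *: "j = j' \<and> i' < i"
      then have "poly_slope p (X z) \<kappa> i (i' + q) j = 0"
        by (intro poly_slope_low[OF lin low]) auto
      then have "F e (z(e' := c)) = F e (z(e' := 0))" for c
        using step[of i j i' z c] e * unfolding ij by simp
      then have "F e (z(e' := c)) = F e (z(e' := z e'))" by metis
      then show ?thesis by simp
    qed
  next
    fix e z assume e: "e \<in> I"
    obtain i j where ij: "e = (i, j)" by (cases e)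
    let ?s = "poly_slope p (X z) \<kappa> i (i + q) j"
    have "?s = poly_slope p y \<kappa> i (i + q) j"
      by (rule poly_slope_cong[OF lin]) (auto simp: X_def)
    then have "?s \<noteq> 0" using y e ij by simp
    moreover have "F e (z(e := c)) = F e (z(e := 0)) + c * ?s" for c
      using step[of i j i z c] e unfolding ij by blast
    ultimately have "F e (z(e := (B i j - F e (z(e := 0))) / ?s)) = B i j"
      by (metis add_diff_cancel_left' diff_add_cancel nonzero_eq_divide_eq add.commute)
    then show "\<exists>c. F e (z(e := c)) = (case e of (i, j) \<Rightarrow> B i j)" unfolding ij by auto
  qed (rule \<open>finite I\<close>)
  then obtain z where z: "\<forall>e\<in>I. F e z = (case e of (i, j) \<Rightarrow> B i j)" by blast
  have "poly_entry p (X z) i j = B i j" if "(i, j) \<in> I" for i j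
    using bspec[OF z that] by (simp add: F_def)
  then show ?thesis by (intro exI[of _ "X z"]) (auto simp: I_def)
qed

section \<open>Prescribing all entries\<close>

lemma word_entry_scalars:
  fixes D :: "nat \<Rightarrow> 'k::field"
  assumes "distinct w" "i \<le> j"
    and "\<And>k a b. k \<noteq> \<kappa> \<Longrightarrow> x (k, a, b) = (if a = b then D k else 0)"
  shows "word_entry x w i j = prod_list (map D (removeAll \<kappa> w)) *
    (if \<kappa> \<in> set w then x (\<kappa>, i, j) else if i = j then 1 else 0)"
  using assms(1,2)
proof (induction w arbitrary: i)
  case (Cons k w)
  show ?case
  proof (cases "k = \<kappa>")
    case True
    have "(\<Sum>l=i..j. x (\<kappa>, i, l) * word_entry x w l j)
        = (\<Sum>l=i..j. if l = j then x (\<kappa>, i, j) * prod_list (map D (removeAll \<kappa> w)) else 0)"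
      using Cons True by (intro sum.cong) auto
    then show ?thesis using True Cons.prems by (simp add: mult.commute)
  next
    case False
    have "(\<Sum>l=i..j. x (k, i, l) * word_entry x w l j)
        = (\<Sum>l=i..j. if l = i then D k * word_entry x w i j else 0)"
      using assms(3)[OF False] by (intro sum.cong) auto
    then show ?thesis using False Cons by simp
  qed
qed simp

text \<open>
  Setting all diagonal coordinates at \<open>0\<close> to zero kills the entry at \<open>(0, 0)\<close>, because \<open>p\<close> has no
  constant term. So that entry changes with a single coordinate, of a variable \<open>\<kappa>\<close>. With
  the diagonal entries at \<open>0\<close> of the other matrices as scalars \<open>D\<close>, the value of \<open>p\<close> is \<open>s\<close>
  times the matrix of \<open>\<kappa>\<close> plus \<open>s0\<close> times the identity, and \<open>s\<close> is nonzero because of this change.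
\<close>

lemma all_entries_solvable:
  fixes p :: "'k::field ncpoly" and B :: "nat \<Rightarrow> nat \<Rightarrow> 'k"
  assumes lin: "linear_ncpoly m p" and nz: "poly_entry p x0 0 0 \<noteq> 0"
  shows "\<exists>x. \<forall>i j. i \<le> j \<longrightarrow> poly_entry p x i j = B i j"
proof -
  note keys = linear_ncpoly_keys[OF lin]
  let ?f = "\<lambda>x. poly_entry p x 0 0" and ?V = "{1..m} \<times> {0::nat} \<times> {0::nat}"
  have "word_entry (\<lambda>v. if v \<in> ?V then 0 else x0 v) w 0 0 = 0" if "w \<in> Poly_Mapping.keys p" for w
    using keys(2,3)[OF that] by (cases w) auto
  then have "?f (\<lambda>v. if v \<in> ?V then 0 else x0 v) \<noteq> ?f x0" using nz by (simp add: poly_entry_def)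
  then obtain v y where v: "v \<in> ?V" "?f (y(v := 0)) \<noteq> ?f y"
    using some_coordinate_matters[of ?V ?f x0] by blast
  then obtain \<kappa> where \<kappa>: "v = (\<kappa>, 0, 0)" by auto
  define D where "D k = y (k, 0, 0)" for k
  define coef where "coef w = Poly_Mapping.lookup p w * prod_list (map D (removeAll \<kappa> w))" for w
  define s where "s = (\<Sum>w\<in>Poly_Mapping.keys p. if \<kappa> \<in> set w then coef w else 0)"
  define s0 where "s0 = (\<Sum>w\<in>Poly_Mapping.keys p. if \<kappa> \<in> set w then 0 else coef w)"
  define X where "X Z = (\<lambda>(k, a, b). if k = \<kappa> then Z a b else if a = b then D k else 0)"
    for Z :: "nat \<Rightarrow> nat \<Rightarrow> 'k"
  have entry: "poly_entry p (X Z) i j = s * Z i j + (if i = j then s0 else 0)" if "i \<le> j" for Z i j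
  proof -
    have "poly_entry p (X Z) i j = (\<Sum>w\<in>Poly_Mapping.keys p.
        (if \<kappa> \<in> set w then coef w else 0) * Z i j
        + (if \<kappa> \<in> set w then 0 else coef w) * (if i = j then 1 else 0))"
      unfolding poly_entry_def
    proof (intro sum.cong refl)
      fix w assume "w \<in> Poly_Mapping.keys p"
      then show "Poly_Mapping.lookup p w * word_entry (X Z) w i j =
          (if \<kappa> \<in> set w then coef w else 0) * Z i j
          + (if \<kappa> \<in> set w then 0 else coef w) * (if i = j then 1 else 0)"
        using word_entry_scalars[OF keys(1) that, of w \<kappa> "X Z" D] by (simp add: X_def coef_def)
    qed
    then show ?thesis by (simp add: sum.distrib sum_distrib_right s_def s0_def)
  qed
  have "?f (y(v := c)) = ?f (X (\<lambda>_ _. c))" for c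
    by (rule poly_entry_cong) (auto simp: X_def D_def \<kappa>)
  from this[of 0] this[of "y v"] have "s \<noteq> 0" using v(2) by (auto simp: entry)
  then have "poly_entry p (X (\<lambda>i j. (B i j - (if i = j then s0 else 0)) / s)) i j = B i j"
    if "i \<le> j" for i j using that by (simp add: entry)
  then show ?thesis by blast
qed

section \<open>Upper triangular matrices\<close>

lemma UT_simps:
  "carrier (UT n) = {A \<in> carrier_mat n n. upper_triangular A}"
  "A \<otimes>\<^bsub>UT n\<^esub> B = A * B" "A \<oplus>\<^bsub>UT n\<^esub> B = A + B" "\<one>\<^bsub>UT n\<^esub> = 1\<^sub>m n" "\<zero>\<^bsub>UT n\<^esub> = 0\<^sub>m n n"
  "c \<odot>\<^bsub>UT n\<^esub> A = c \<cdot>\<^sub>m A"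
  by (simp_all add: UT_def module_mat_def)

lemma word_eval_UT:
  fixes a :: "nat \<Rightarrow> 'k::field mat"
  assumes "\<And>k. k \<in> set w \<Longrightarrow> a k \<in> carrier (UT n)"
  defines "M \<equiv> foldr (\<lambda>i b. a i \<otimes>\<^bsub>UT n\<^esub> b) w \<one>\<^bsub>UT n\<^esub>"
  shows "M \<in> carrier (UT n) \<and> (\<forall>i<n. \<forall>j<n. M $$ (i, j) = word_entry (\<lambda>(k, i, j). a k $$ (i, j)) w i j)"
  using assms(1) unfolding M_def
proof (induction w)
  case Nil
  then show ?case by (auto simp: UT_simps)
next
  case (Cons k w)
  let ?N = "foldr (\<lambda>i b. a i \<otimes>\<^bsub>UT n\<^esub> b) w \<one>\<^bsub>UT n\<^esub>" and ?x = "\<lambda>(k, i, j). a k $$ (i, j)"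
  interpret ring "UT n :: ('k, 'k mat) module" by (rule ring_UT)
  have N: "?N \<in> carrier (UT n)" "\<And>i j. i < n \<Longrightarrow> j < n \<Longrightarrow> ?N $$ (i, j) = word_entry ?x w i j"
    using Cons by auto
  have ak: "a k \<in> carrier (UT n)" using Cons.prems by simp
  have "(a k * ?N) $$ (i, j) = word_entry ?x (k # w) i j" if "i < n" "j < n" for i j
  proof -
    have "(a k * ?N) $$ (i, j) = (\<Sum>l=0..<n. a k $$ (i, l) * ?N $$ (l, j))"
      using ak N(1) that by (auto simp: UT_simps(1) scalar_prod_def)
    also have "\<dots> = (\<Sum>l=0..<n. a k $$ (i, l) * word_entry ?x w l j)"
      using N(2) that by simp
    also have "\<dots> = (\<Sum>l=i..j. a k $$ (i, l) * word_entry ?x w l j)"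
    proof (rule sum.mono_neutral_right)
      show "\<forall>l\<in>{0..<n} - {i..j}. a k $$ (i, l) * word_entry ?x w l j = 0"
      proof
        fix l assume "l \<in> {0..<n} - {i..j}"
        then consider "l < i" | "j < l" by fastforce
        then show "a k $$ (i, l) * word_entry ?x w l j = 0"
          using ak that by cases (auto simp: UT_simps(1) upper_triangular_def word_entry_below_diagonal)
      qed
    qed (use that in auto)
    finally show ?thesis by simp
  qed
  then show ?case using m_closed[OF ak N(1)] by (simp add: UT_simps(2) del: word_entry.simps)
qed

lemma ncpoly_eval_UT:
  fixes p :: "'k::field ncpoly"
  assumes lin: "linear_ncpoly m p" and a: "\<And>k. k \<in> {1..m} \<Longrightarrow> a k \<in> carrier (UT n)"
  shows "ncpoly_eval (UT n) p a \<in> carrier (UT n)"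
    and "i < n \<Longrightarrow> j < n \<Longrightarrow>
      ncpoly_eval (UT n) p a $$ (i, j) = poly_entry p (\<lambda>(k, i, j). a k $$ (i, j)) i j"
proof -
  interpret ring "UT n :: ('k, 'k mat) module" by (rule ring_UT)
  let ?x = "\<lambda>(k, i, j). a k $$ (i, j)"
  define M where "M w = foldr (\<lambda>i b. a i \<otimes>\<^bsub>UT n\<^esub> b) w \<one>\<^bsub>UT n\<^esub>" for w
  have M: "M w \<in> carrier (UT n)" "\<And>i j. i < n \<Longrightarrow> j < n \<Longrightarrow> M w $$ (i, j) = word_entry ?x w i j"
    if "w \<in> Poly_Mapping.keys p" for w
    using word_eval_UT[of w a n] a linear_ncpoly_keys(2)[OF lin that] unfolding M_def by blast+
  have scaled: "c \<odot>\<^bsub>UT n\<^esub> M w \<in> carrier (UT n)" if "w \<in> Poly_Mapping.keys p" for c w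
    using M(1)[OF that] by (auto simp: UT_simps upper_triangular_def)
  have "(\<Oplus>\<^bsub>UT n\<^esub>w\<in>S. Poly_Mapping.lookup p w \<odot>\<^bsub>UT n\<^esub> M w) \<in> carrier (UT n) \<and>
      (\<forall>i<n. \<forall>j<n. (\<Oplus>\<^bsub>UT n\<^esub>w\<in>S. Poly_Mapping.lookup p w \<odot>\<^bsub>UT n\<^esub> M w) $$ (i, j)
        = (\<Sum>w\<in>S. Poly_Mapping.lookup p w * word_entry ?x w i j))"
    if "finite S" "S \<subseteq> Poly_Mapping.keys p" for S
    using that
  proof (induction S rule: finite_induct)
    case empty
    then show ?case by (auto simp: UT_simps)
  next
    case (insert w S)
    let ?g = "\<lambda>w. Poly_Mapping.lookup p w \<odot>\<^bsub>UT n\<^esub> M w"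
    have w: "w \<in> Poly_Mapping.keys p" and S: "S \<subseteq> Poly_Mapping.keys p" using insert.prems by auto
    have eq: "(\<Oplus>\<^bsub>UT n\<^esub>w\<in>insert w S. ?g w) = ?g w \<oplus>\<^bsub>UT n\<^esub> (\<Oplus>\<^bsub>UT n\<^esub>w\<in>S. ?g w)"
      using insert.hyps scaled w S by (intro finsum_insert) auto
    have cS: "(\<Oplus>\<^bsub>UT n\<^esub>w\<in>S. ?g w) \<in> carrier (UT n)" using insert.IH[OF S] by blast
    have "(?g w \<oplus>\<^bsub>UT n\<^esub> (\<Oplus>\<^bsub>UT n\<^esub>w\<in>S. ?g w)) $$ (i, j) = (\<Sum>w\<in>insert w S.
        Poly_Mapping.lookup p w * word_entry ?x w i j)" if "i < n" "j < n" for i j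
    proof -
      have "(?g w \<oplus>\<^bsub>UT n\<^esub> (\<Oplus>\<^bsub>UT n\<^esub>w\<in>S. ?g w)) $$ (i, j)
          = ?g w $$ (i, j) + (\<Oplus>\<^bsub>UT n\<^esub>w\<in>S. ?g w) $$ (i, j)"
        using cS that by (auto simp: UT_simps(1,3))
      moreover have "?g w $$ (i, j) = Poly_Mapping.lookup p w * word_entry ?x w i j"
        using M(1)[OF w] M(2)[OF w that] that by (auto simp: UT_simps(1,6))
      ultimately show ?thesis using insert.IH[OF S] insert.hyps that by simp
    qed
    then show ?case unfolding eq using a_closed[OF scaled[OF w] cS] by blast
  qed
  from this[of "Poly_Mapping.keys p"]
  have "ncpoly_eval (UT n) p a \<in> carrier (UT n) \<and>
      (\<forall>i<n. \<forall>j<n. ncpoly_eval (UT n) p a $$ (i, j) = poly_entry p ?x i j)"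
    unfolding ncpoly_eval_def poly_entry_def M_def by simp
  then show "ncpoly_eval (UT n) p a \<in> carrier (UT n)"
    and "i < n \<Longrightarrow> j < n \<Longrightarrow> ncpoly_eval (UT n) p a $$ (i, j) = poly_entry p ?x i j" by blast+
qed

section \<open>The image of a linear polynomial\<close>

theorem theorem1p2:
  fixes p :: "'k::field ncpoly" and m n :: nat
  assumes "m \<ge> 1" and "n \<ge> 2"
    and "linear_ncpoly m p" and "p \<noteq> 0"
    and "infinite (UNIV :: 'k set) \<or> real (card (UNIV :: 'k set)) > real n * (real n - 1) / 3"
  shows "\<exists>t::int. -1 \<le> t \<and> real_of_int t \<le> real m / 2 - 1 \<and>
    ncpoly_image m p (UT n) = UT_diag n t"
proof -
  note lin = assms(3)
  obtain s x where s: "2 * s \<le> m" "poly_entry p x 0 s \<noteq> 0"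
    using exists_nonzero_entry[OF lin assms(4)] by blast
  define r where "r = (LEAST r. \<exists>x. poly_entry p x 0 r \<noteq> 0)"
  obtain x0 where x0: "poly_entry p x0 0 r \<noteq> 0"
    using LeastI[of "\<lambda>r. \<exists>x. poly_entry p x 0 r \<noteq> 0" s] s(2) unfolding r_def by blast
  have low: "poly_entry p x 0 s = 0" if "s < r" for x s
    using not_less_Least[of s "\<lambda>r. \<exists>x. poly_entry p x 0 r \<noteq> 0"] that unfolding r_def by blast
  have "r \<le> s" unfolding r_def by (rule Least_le) (use s(2) in blast)
  have large: "infinite (UNIV :: 'k set) \<or> n * (n - 1) < 3 * card (UNIV :: 'k set)"
  proof (rule disj_forward[OF assms(5)])
    assume "real (card (UNIV :: 'k set)) > real n * (real n - 1) / 3"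
    then have "real (n * (n - 1)) < real (3 * card (UNIV :: 'k set))"
      using assms(2) by (simp add: of_nat_diff field_simps)
    then show "n * (n - 1) < 3 * card (UNIV :: 'k set)" by (simp only: of_nat_less_iff)
  qed
  have solvable: "\<exists>x. \<forall>i j. i + r \<le> j \<and> j < n \<longrightarrow> poly_entry p x i j = B i j" for B
  proof (cases r)
    case 0
    then show ?thesis using all_entries_solvable[OF lin, of x0 B] x0 by auto
  next
    case (Suc q)
    then show ?thesis using entries_solvable[OF lin, of q x0 n B] low x0 large by blast
  qed
  have "ncpoly_image m p (UT n) = UT_diag n (int r - 1)"
  proof
    show "ncpoly_image m p (UT n) \<subseteq> UT_diag n (int r - 1)"
    proof
      fix A assume "A \<in> ncpoly_image m p (UT n)"
      then obtain a where A: "A = ncpoly_eval (UT n) p a"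
        and a: "\<And>k. k \<in> {1..m} \<Longrightarrow> a k \<in> carrier (UT n)" unfolding ncpoly_image_def by blast
      have "A $$ (i, j) = 0" if "i < n" "j < n" "int j - int i \<le> int r - 1" for i j
        using ncpoly_eval_UT(2)[of m p a n, OF lin a that(1,2)] poly_entry_low[OF low, of r j i] that(3)
        unfolding A by simp
      then show "A \<in> UT_diag n (int r - 1)"
        using ncpoly_eval_UT(1)[of m p a n, OF lin a] unfolding A UT_diag_def by blast
    qed
    show "UT_diag n (int r - 1) \<subseteq> ncpoly_image m p (UT n)"
    proof
      fix A :: "'k mat" assume A: "A \<in> UT_diag n (int r - 1)"
      obtain x where x: "\<And>i j. i + r \<le> j \<Longrightarrow> j < n \<Longrightarrow> poly_entry p x i j = A $$ (i, j)"
        using solvable[of "\<lambda>i j. A $$ (i, j)"] by blast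
      define a where "a k = mat n n (\<lambda>(i, j). if i \<le> j then x (k, i, j) else 0)" for k
      have a: "a k \<in> carrier (UT n)" for k
        by (auto simp: a_def UT_simps upper_triangular_def)
      have "ncpoly_eval (UT n) p a = A"
      proof (rule eq_matI)
        show "ncpoly_eval (UT n) p a $$ (i, j) = A $$ (i, j)"
          if "i < dim_row A" "j < dim_col A" for i j
        proof -
          have ij: "i < n" "j < n" using that A by (auto simp: UT_diag_def UT_simps)
          have "ncpoly_eval (UT n) p a $$ (i, j) = poly_entry p (\<lambda>(k, i, j). a k $$ (i, j)) i j"
            using ncpoly_eval_UT(2)[of m p a n, OF lin a ij] .
          also have "\<dots> = poly_entry p x i j"
            by (rule poly_entry_cong) (use ij in \<open>auto simp: a_def\<close>)
          also have "\<dots> = A $$ (i, j)"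
          proof (cases "i + r \<le> j")
            case False
            then have "A $$ (i, j) = 0" using A ij by (auto simp: UT_diag_def)
            then show ?thesis using poly_entry_low[OF low, of r j i] False by simp
          qed (use x ij in auto)
          finally show ?thesis .
        qed
      qed (use A ncpoly_eval_UT(1)[of m p a n, OF lin a] in \<open>auto simp: UT_diag_def UT_simps\<close>)
      then show "A \<in> ncpoly_image m p (UT n)" using a unfolding ncpoly_image_def by blast
    qed
  qed
  then show ?thesis using s(1) \<open>r \<le> s\<close> by (intro exI[of _ "int r - 1"]) auto
qed

end
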